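(* Let $N=(V,E)$ be a directed network embedded on a closed orientable surface with boundary such that every vertex is contained in some path between boundary vertices. If there exist collections $\{\epsilon_e\}_{e\in E},\{\epsilon'_e\}_{e\in E}\in\{\pm1\}^E$ such that $$B(N,\{x_e\}_{e\in E})=A(N,\{\epsilon_e x_e\}_{e\in E})\quad\text{and}\quad B(N,\{x_e\}_{e\in E})=A(N,\{\epsilon'_e x_e\}_{e\in E}),$$ then $\{\epsilon_e\}_{e\in E}$ and $\{\epsilon'_e\}_{e\in E}$ are gauge equivalent (i.e. $\{\epsilon_e x_e\}_{e\in E}$ and $\{\epsilon'_e x_e\}_{e\in E}$ are gauge equivalent elements of the weight space $\mathcal{X}(N)$).
   Context: A "closed orientable surface with boundary" $S$ is a compact orientable surface with $b\ge 1$ boundary components, each a smooth curve diffeomorphic to a circle. A directed network $N=(V,E)$ is a finite directed graph with a formal variable $x_e$ attached to each edge $e\in E$; all expressions live in the ring of formal power series $\mathbb{R}[[x_e:e\in E]]$. $N$ is embedded in $S$ with edges smooth curves. Vertices on $\partial S$ are called boundary vertices; $K\subseteq V$ is the set of boundary vertices, each is assumed to be a source or a sink, and $I\subseteq K$ is the set of boundary sources. A path $P:i\rightsquigarrow j$ is a finite sequence of edges $(e_1,\dots,e_l)$ with consecutive heads and tails matching, starting at $i$ and ending at $j$ (vertices and edges may be repeated), with weight $\mathrm{wt}(P)=\prod_k x_{e_k}$; the empty path from $i$ to $i$ is allowed and has weight $1$. The matrix $A(N,\{x_e\}_{e\in E})$ is the $I\times K$ matrix with entries $A_{ij}=\sum_{P:i\rightsquigarrow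 j}\mathrm{wt}(P)$; $A(N,\{a_e x_e\}_{e\in E})$ is obtained by substituting $a_e x_e$ for $x_e$. Gauge action. Let $\mathrm{int}(V)=V\setminus K$ and $\mathbb{R}^*=\mathbb{R}\setminus\{0\}$. The gauge group is $\mathcal{G}(N)=(\mathbb{R}^* )^{\mathrm{int}(V)}$. The weight space $\mathcal{X}(N)$ is the set of all collections $\{a_e x_e\}_{e\in E}$ with $a_e\in\mathbb{R}^*$. An element $g=(g_v)_{v\in\mathrm{int}(V)}$ acts by $g\cdot\{a_e x_e\}=\{(g\cdot a_e)x_e\}$, where for $e=(i,j)$ (directed from $i$ to $j$) $g\cdot a_e=g_j^{-1}a_e g_i$, with $g_v=1$ for $v\in K$. $X,Y\in\mathcal{X}(N)$ are gauge equivalent if $Y=g\cdot X$ for some $g\in\mathcal{G}(N)$. Cuts and ordering. Make $b-1$ cuts between pairs of boundary components of $S$ (smooth curves avoiding the vertices of $N$ and transversal to its edges) so as to obtain a surface $T$ with a single boundary component. Choose a piecewise smooth parameterization $\phi:[0,1]\to\partial T$, $\phi(0)=\phi(1)$, with nowhere zero derivative. This gives a direction on $\partial T$ and a linear order $<$ on $K$, the order in which the boundary vertices are met as $\phi$ traverses $\partial T$. Representation of $S$ in the plane. If the genus of $S$ is $0$: choose one boundary component ("external"), identify it with a circle bounding a disk in the plane, and draw $S$, $N$ and the cuts inside this disk. If the genus is $g>0$: choose generators of the first homology group of the underlying closed surface without boundary, avoiding vertices of $N$ and meeting edges of $N$ and the cuts transversally, so that $S$ is represented by a punctured fundamental polygon: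 the usual $4g$-sided fundamental polygon (sides corresponding to the homology generators), with disks removed for the boundary components, from which $S$ is recovered by identifying corresponding sides. Draw $N$ and the cuts inside this single fundamental domain. Curves and rotation numbers. For a path $P:i\rightsquigarrow j$ with $(i,j)\in I\times K$, the closed planar curve $C(P)$ is obtained by traversing $P$ from $i$ to $j$ and then following $\partial T$ in the chosen direction from $j$ to $i$; in genus $g>0$, each time the curve leaves the fundamental polygon the exit point is connected to the entry point by following the sides of the polygon clockwise. Corners are smoothed. The rotation number of a smooth closed planar curve is the degree of its unit tangent map $S^1\to S^1$; $r_P$ is the rotation number of $C(P)$. Boundary measurement matrix (all choices above being fixed): $B(N,\{x_e\}_{e\in E})$ is the $I\times K$ matrix with $B_{ij}=\sum_{P:i\rightsquigarrow j}(-1)^{s_{ij}+r_P+1}\mathrm{wt}(P)$, where $s_{ij}$ is the number of elements of $I$ strictly between $i$ and $j$ with respect to $<$. (For $i=j$ the only path is the empty one, and it contributes $B_{ii}=1$.) *)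

theory Defs
  imports "HOL-Complex_Analysis.Complex_Analysis" "Graph_Theory.Graph_Theory"
    "HOL-Library.Multiset"
begin

section \<open>Smooth maps on subsets of Euclidean spaces\<close>

primrec C_k :: "nat \<Rightarrow> 'a::euclidean_space set \<Rightarrow> ('a \<Rightarrow> 'b::euclidean_space) \<Rightarrow> bool" where
  "C_k 0 W = (\<lambda>f. continuous_on W f)"
| "C_k (Suc n) W = (\<lambda>f. (\<forall>x\<in>W. f differentiable (at x)) \<and>
     (\<forall>v\<in>Basis. C_k n W (\<lambda>x. frechet_derivative f (at x) v)))"

definition local_smooth_extension ::
    "'a::euclidean_space set \<Rightarrow> ('a \<Rightarrow> 'b::euclidean_space) \<Rightarrow> 'a \<Rightarrow> ('a \<Rightarrow> 'b) \<Rightarrow> bool" where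
  "local_smooth_extension D f x h \<longleftrightarrow>
     (\<exists>W. open W \<and> x \<in> W \<and> (\<forall>n. C_k n W h) \<and> (\<forall>y\<in>D \<inter> W. h y = f y))"

definition smooth_on :: "'a::euclidean_space set \<Rightarrow> ('a \<Rightarrow> 'b::euclidean_space) \<Rightarrow> bool" where
  "smooth_on D f \<longleftrightarrow> (\<forall>x\<in>D. \<exists>h. local_smooth_extension D f x h)"

text \<open>For a curve (a real domain) injectivity of the derivative says that the velocity is nonzero.\<close>

definition smooth_immersion_on ::
    "'a::euclidean_space set \<Rightarrow> ('a \<Rightarrow> 'b::euclidean_space) \<Rightarrow> bool" where
  "smooth_immersion_on D f \<longleftrightarrow>
     (\<forall>x\<in>D. \<exists>h. local_smooth_extension D f x h \<and> inj (frechet_derivative h (at x)))"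

section \<open>Surfaces with boundary\<close>

definition half_plane :: "complex set" where
  "half_plane = {z. 0 \<le> Im z}"

definition is_chart :: "'p topology \<Rightarrow> 'p set \<Rightarrow> ('p \<Rightarrow> complex) \<Rightarrow> bool" where
  "is_chart X U \<phi> \<longleftrightarrow> openin X U \<and> openin (top_of_set half_plane) (\<phi> ` U) \<and>
     homeomorphic_map (subtopology X U) (top_of_set (\<phi> ` U)) \<phi>"

text \<open>By invariance of domain, membership in the boundary does not depend on the chart.\<close>

definition surface_boundary :: "'p topology \<Rightarrow> 'p set" where
  "surface_boundary X = {p. \<exists>U \<phi>. is_chart X U \<phi> \<and> p \<in> U \<and> Im (\<phi> p) = 0}"

definition boundary_components :: "'p topology \<Rightarrow> 'p set set" where
  "boundary_components X = connected_components_of (subtopology X (surface_boundary X))"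

definition compact_topological_surface :: "'p topology \<Rightarrow> bool" where
  "compact_topological_surface X \<longleftrightarrow> compact_space X \<and> Hausdorff_space X \<and>
     (\<forall>p\<in>topspace X. \<exists>U \<phi>. is_chart X U \<phi> \<and> p \<in> U)"

type_synonym 'p atlas = "('p set \<times> ('p \<Rightarrow> complex)) set"

definition smooth_atlas :: "'p topology \<Rightarrow> 'p atlas \<Rightarrow> bool" where
  "smooth_atlas X A \<longleftrightarrow>
     (\<forall>(U, \<phi>)\<in>A. is_chart X U \<phi>) \<and> \<Union> (fst ` A) = topspace X \<and>
     (\<forall>(U, \<phi>)\<in>A. \<forall>(V, \<psi>)\<in>A. smooth_on (\<phi> ` (U \<inter> V)) (\<psi> \<circ> inv_into U \<phi>))"

text \<open>For a real linear map \<open>J\<close> of the complex plane, \<open>Im (cnj (J 1) * J \<i>)\<close> is its determinant.\<close>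

definition oriented_atlas :: "'p topology \<Rightarrow> 'p atlas \<Rightarrow> bool" where
  "oriented_atlas X A \<longleftrightarrow> smooth_atlas X A \<and>
     (\<forall>(U, \<phi>)\<in>A. \<forall>(V, \<psi>)\<in>A. \<forall>z\<in>interior (\<phi> ` (U \<inter> V)).
        let J = frechet_derivative (\<psi> \<circ> inv_into U \<phi>) (at z) in 0 < Im (cnj (J 1) * J \<i>))"

record 'p surface =
  points :: "'p topology"
  atlas :: "'p atlas"

definition smooth_regular_curve :: "'p surface \<Rightarrow> real set \<Rightarrow> (real \<Rightarrow> 'p) \<Rightarrow> bool" where
  "smooth_regular_curve S J c \<longleftrightarrow>
     continuous_map (top_of_set J) (points S) c \<and>
     (\<forall>(U, \<phi>)\<in>atlas S. smooth_immersion_on {t\<in>J. c t \<in> U} (\<phi> \<circ> c))"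

definition piecewise_smooth_regular_curve :: "'p surface \<Rightarrow> (real \<Rightarrow> 'p) \<Rightarrow> bool" where
  "piecewise_smooth_regular_curve S c \<longleftrightarrow>
     (\<exists>n t. t 0 = (0::real) \<and> t n = 1 \<and>
        (\<forall>m<(n::nat). t m < t (Suc m) \<and> smooth_regular_curve S {t m..t (Suc m)} c))"

definition closed_orientable_surface_with_boundary :: "'p surface \<Rightarrow> bool" where
  "closed_orientable_surface_with_boundary S \<longleftrightarrow>
     compact_topological_surface (points S) \<and> connected_space (points S) \<and>
     smooth_atlas (points S) (atlas S) \<and>
     (\<exists>A. oriented_atlas (points S) A \<and> smooth_atlas (points S) (atlas S \<union> A)) \<and>
     finite (boundary_components (points S)) \<and> boundary_components (points S) \<noteq> {} \<and>
     (\<forall>C\<in>boundary_components (points S). \<exists>c. smooth_regular_curve S UNIV c \<and>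
        (\<forall>t. c (t + 1) = c t) \<and> inj_on c {0..<1} \<and> c ` UNIV = C)"

definition transversal_at ::
    "'p surface \<Rightarrow> (real \<Rightarrow> 'p) \<Rightarrow> real \<Rightarrow> (real \<Rightarrow> 'p) \<Rightarrow> real \<Rightarrow> bool" where
  "transversal_at S c t d s \<longleftrightarrow>
     (\<forall>(U, \<phi>)\<in>atlas S. c t \<in> U \<longrightarrow>
        Im (cnj (vector_derivative (\<phi> \<circ> c) (at t within {0..1})) *
            vector_derivative (\<phi> \<circ> d) (at s within {0..1})) \<noteq> 0)"

section \<open>Directed networks on a surface\<close>

record ('p, 'e) network =
  graph :: "('p, 'e) pre_digraph"
  curve :: "'e \<Rightarrow> real \<Rightarrow> 'p"

definition boundary_vertices :: "'p surface \<Rightarrow> ('p, 'e) network \<Rightarrow> 'p set" where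
  "boundary_vertices S N = verts (graph N) \<inter> surface_boundary (points S)"

definition boundary_sources :: "'p surface \<Rightarrow> ('p, 'e) network \<Rightarrow> 'p set" where
  "boundary_sources S N = {v \<in> boundary_vertices S N. in_arcs (graph N) v = {}}"

definition embedded_network :: "'p surface \<Rightarrow> ('p, 'e) network \<Rightarrow> bool" where
  "embedded_network S N \<longleftrightarrow>
     fin_digraph (graph N) \<and> verts (graph N) \<subseteq> topspace (points S) \<and>
     (\<forall>e\<in>arcs (graph N).
        smooth_regular_curve S {0..1} (curve N e) \<and>
        curve N e 0 = tail (graph N) e \<and> curve N e 1 = head (graph N) e \<and>
        inj_on (curve N e) {0<..<1} \<and> curve N e ` {0<..<1} \<inter> verts (graph N) = {}) \<and>
     (\<forall>e\<in>arcs (graph N). \<forall>e'\<in>arcs (graph N). e \<noteq> e' \<longrightarrow>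
        curve N e ` {0<..<1} \<inter> curve N e' ` {0<..<1} = {}) \<and>
     (\<forall>v\<in>boundary_vertices S N. in_arcs (graph N) v = {} \<or> out_arcs (graph N) v = {})"

text \<open>Arc walks may repeat vertices and arcs and include the empty walk.\<close>

definition paths :: "('p, 'e) network \<Rightarrow> 'p \<Rightarrow> 'p \<Rightarrow> 'e list set" where
  "paths N i j = {P. pre_digraph.awalk (graph N) i P j}"

section \<open>Formal power series in the edge variables\<close>

text \<open>A power series is given by its coefficients; a multiset of edges is the exponent of a monomial.\<close>

type_synonym 'e power_series = "'e multiset \<Rightarrow> real"

definition monomial :: "real \<Rightarrow> 'e multiset \<Rightarrow> 'e power_series" where
  "monomial a m = (\<lambda>m'. if m' = m then a else 0)"

definition formal_sum :: "'i set \<Rightarrow> ('i \<Rightarrow> 'e power_series) \<Rightarrow> 'e power_series" where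
  "formal_sum X f = (\<lambda>m. \<Sum>i\<in>{i\<in>X. f i m \<noteq> 0}. f i m)"

text \<open>The weight of \<open>P\<close> when each edge \<open>e\<close> carries \<open>a\<^sub>e x\<^sub>e\<close>.\<close>

definition wt :: "('e \<Rightarrow> real) \<Rightarrow> 'e list \<Rightarrow> 'e power_series" where
  "wt a P = monomial (\<Prod>e\<leftarrow>P. a e) (mset P)"

definition A_entry :: "('p, 'e) network \<Rightarrow> ('e \<Rightarrow> real) \<Rightarrow> 'p \<Rightarrow> 'p \<Rightarrow> 'e power_series" where
  "A_entry N a i j = formal_sum (paths N i j) (wt a)"

section \<open>Gauge action\<close>

definition weight_space :: "('p, 'e) network \<Rightarrow> ('e \<Rightarrow> real) set" where
  "weight_space N = {a. \<forall>e\<in>arcs (graph N). a e \<noteq> 0}"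

definition gauge_group :: "'p surface \<Rightarrow> ('p, 'e) network \<Rightarrow> ('p \<Rightarrow> real) set" where
  "gauge_group S N = {g. \<forall>v\<in>verts (graph N) - boundary_vertices S N. g v \<noteq> 0}"

definition gauge_act ::
    "'p surface \<Rightarrow> ('p, 'e) network \<Rightarrow> ('p \<Rightarrow> real) \<Rightarrow> ('e \<Rightarrow> real) \<Rightarrow> 'e \<Rightarrow> real" where
  "gauge_act S N g a e =
     (let h = (\<lambda>v. if v \<in> boundary_vertices S N then 1 else g v)
      in inverse (h (head (graph N) e)) * a e * h (tail (graph N) e))"

definition gauge_equivalent ::
    "'p surface \<Rightarrow> ('p, 'e) network \<Rightarrow> ('e \<Rightarrow> real) \<Rightarrow> ('e \<Rightarrow> real) \<Rightarrow> bool" where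
  "gauge_equivalent S N a a' \<longleftrightarrow>
     a \<in> weight_space N \<and> a' \<in> weight_space N \<and>
     (\<exists>g\<in>gauge_group S N. \<forall>e\<in>arcs (graph N). a' e = gauge_act S N g a e)"

section \<open>Cuts and planar drawings\<close>

text \<open>
  The auxiliary choices made for a network on a surface: the cuts; the cut-open surface \<open>T\<close>, its
  map \<open>reglue\<close> back to the surface, and a parameterization of its boundary; and a planar domain
  \<open>domain\<close> with the map \<open>proj\<close> to the surface.
  For genus 0 the map \<open>proj\<close> is the inverse of the drawing in a disk. For positive genus it is the
  quotient map of the punctured fundamental polygon, whose existence makes \<open>genus\<close> the genus
  of the surface.
\<close>

record ('p, 'q) presentation =
  cuts :: "(real \<Rightarrow> 'p) set"
  cut_open :: "'q topology"
  reglue :: "'q \<Rightarrow> 'p"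
  traverse :: "real \<Rightarrow> 'q"
  genus :: nat
  "domain" :: "complex set"
  proj :: "complex \<Rightarrow> 'p"

definition cut_points :: "('p, 'q) presentation \<Rightarrow> 'p set" where
  "cut_points R = (\<Union>c\<in>cuts R. c ` {0..1})"

definition valid_cuts :: "'p surface \<Rightarrow> ('p, 'e) network \<Rightarrow> ('p, 'q) presentation \<Rightarrow> bool" where
  "valid_cuts S N R \<longleftrightarrow>
     finite (cuts R) \<and> card (cuts R) = card (boundary_components (points S)) - 1 \<and>
     (\<forall>c\<in>cuts R.
        smooth_regular_curve S {0..1} c \<and> inj_on c {0..1} \<and>
        (\<exists>C\<in>boundary_components (points S). \<exists>C'\<in>boundary_components (points S).
           C \<noteq> C' \<and> c 0 \<in> C \<and> c 1 \<in> C') \<and>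
        c ` {0<..<1} \<inter> surface_boundary (points S) = {} \<and>
        c ` {0..1} \<inter> verts (graph N) = {} \<and>
        (\<forall>e\<in>arcs (graph N). \<forall>s\<in>{0..1}. \<forall>t\<in>{0..1}.
           curve N e s = c t \<longrightarrow> transversal_at S (curve N e) s c t)) \<and>
     (\<forall>c\<in>cuts R. \<forall>d\<in>cuts R. c \<noteq> d \<longrightarrow> c ` {0..1} \<inter> d ` {0..1} = {})"

text \<open>\<open>T\<close> has a copy of every cut point for each of the two sides of the cut.\<close>

definition valid_cut_open :: "'p surface \<Rightarrow> ('p, 'q) presentation \<Rightarrow> bool" where
  "valid_cut_open S R \<longleftrightarrow>
     compact_topological_surface (cut_open R) \<and>
     continuous_map (cut_open R) (points S) (reglue R) \<and>
     (\<forall>p\<in>topspace (points S). card {q\<in>topspace (cut_open R). reglue R q = p} =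
        (if p \<in> cut_points R then 2 else 1)) \<and>
     surface_boundary (cut_open R) =
       {q\<in>topspace (cut_open R). reglue R q \<in> surface_boundary (points S) \<union> cut_points R} \<and>
     card (boundary_components (cut_open R)) = 1"

definition valid_traversal :: "'p surface \<Rightarrow> ('p, 'q) presentation \<Rightarrow> bool" where
  "valid_traversal S R \<longleftrightarrow>
     pathin (cut_open R) (traverse R) \<and> traverse R 0 = traverse R 1 \<and>
     inj_on (traverse R) {0..<1} \<and>
     traverse R ` {0..1} = surface_boundary (cut_open R) \<and>
     piecewise_smooth_regular_curve S (reglue R \<circ> traverse R)"

text \<open>
  \<open>polygon_point g\<close> runs counterclockwise, with period \<open>4 * g\<close>, around the regular
  \<open>4 * g\<close>-gon; the side number \<open>k\<close> is the image of the interval from \<open>k\<close> to \<open>k + 1\<close>.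
\<close>

definition polygon_point :: "nat \<Rightarrow> real \<Rightarrow> complex" where
  "polygon_point g x =
     linepath (cis (2 * pi * of_int \<lfloor>x\<rfloor> / (4 * real g)))
              (cis (2 * pi * of_int (\<lfloor>x\<rfloor> + 1) / (4 * real g))) (frac x)"

definition polygon_corners :: "nat \<Rightarrow> complex set" where
  "polygon_corners g = (if g = 0 then {} else polygon_point g ` \<int>)"

definition polygon_sides :: "nat \<Rightarrow> complex set" where
  "polygon_sides g = (if g = 0 then {} else range (polygon_point g))"

text \<open>
  The side word is the product of the commutators \<open>a\<^sub>m b\<^sub>m a\<^sub>m\<inverse> b\<^sub>m\<inverse>\<close> for \<open>m < g\<close>. All corners
  are glued to one point.
\<close>

definition glued :: "nat \<Rightarrow> complex \<Rightarrow> complex \<Rightarrow> bool" where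
  "glued g z w \<longleftrightarrow>
     z = w \<or> (z \<in> polygon_corners g \<and> w \<in> polygon_corners g) \<or>
     (\<exists>m<g. \<exists>s\<in>{0..1}.
        {z, w} = {polygon_point g (4 * real m + s), polygon_point g (4 * real m + 3 - s)} \<or>
        {z, w} = {polygon_point g (4 * real m + 1 + s), polygon_point g (4 * real m + 4 - s)})"

definition planar_domain :: "'p surface \<Rightarrow> ('p, 'q) presentation \<Rightarrow> bool" where
  "planar_domain S R \<longleftrightarrow>
     (if genus R = 0
      then compact (domain R) \<and>
        (\<exists>a r. 0 < r \<and> sphere a r \<subseteq> domain R \<and> domain R \<subseteq> cball a r \<and>
           proj R ` sphere a r \<in> boundary_components (points S))
      else \<exists>Q. finite Q \<and>
        (\<forall>(a, r)\<in>Q. 0 < r \<and> cball a r \<subseteq> interior (convex hull polygon_corners (genus R))) \<and>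
        (\<forall>(a, r)\<in>Q. \<forall>(a', r')\<in>Q. (a, r) \<noteq> (a', r') \<longrightarrow> cball a r \<inter> cball a' r' = {}) \<and>
        domain R = convex hull polygon_corners (genus R) - (\<Union>(a, r)\<in>Q. ball a r))"

text \<open>
  Smoothness is not required at the corners of the polygon: in general the corner angles add up
  to more than a full turn there.
\<close>

definition valid_drawing :: "'p surface \<Rightarrow> ('p, 'e) network \<Rightarrow> ('p, 'q) presentation \<Rightarrow> bool" where
  "valid_drawing S N R \<longleftrightarrow>
     planar_domain S R \<and>
     continuous_map (top_of_set (domain R)) (points S) (proj R) \<and>
     proj R ` domain R = topspace (points S) \<and>
     (\<forall>z\<in>domain R. \<forall>w\<in>domain R. proj R z = proj R w \<longleftrightarrow> glued (genus R) z w) \<and>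
     (\<forall>(U, \<phi>)\<in>atlas S.
        smooth_immersion_on {z\<in>domain R - polygon_corners (genus R). proj R z \<in> U} (\<phi> \<circ> proj R)) \<and>
     verts (graph N) \<inter> proj R ` polygon_sides (genus R) = {} \<and>
     (\<forall>c\<in>curve N ` arcs (graph N) \<union> cuts R.
        c ` {0..1} \<inter> proj R ` polygon_corners (genus R) = {} \<and>
        (\<forall>k<4 * genus R. \<forall>s\<in>{0<..<1}. \<forall>t\<in>{0..1}.
           c t = proj R (polygon_point (genus R) (real k + s)) \<longrightarrow>
           transversal_at S c t (\<lambda>s. proj R (polygon_point (genus R) (real k + s))) s))"

definition valid_presentation ::
    "'p surface \<Rightarrow> ('p, 'e) network \<Rightarrow> ('p, 'q) presentation \<Rightarrow> bool" where
  "valid_presentation S N R \<longleftrightarrow>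
     valid_cuts S N R \<and> valid_cut_open S R \<and> valid_traversal S R \<and> valid_drawing S N R"

section \<open>The linear order on the boundary vertices\<close>

text \<open>Boundary vertices avoid the cuts, so each of them is met exactly once.\<close>

definition meeting_time :: "('p, 'q) presentation \<Rightarrow> 'p \<Rightarrow> real" where
  "meeting_time R v = (THE t. t \<in> {0..<1} \<and> reglue R (traverse R t) = v)"

definition sources_between ::
    "'p surface \<Rightarrow> ('p, 'e) network \<Rightarrow> ('p, 'q) presentation \<Rightarrow> 'p \<Rightarrow> 'p \<Rightarrow> nat" where
  "sources_between S N R i j =
     (let \<tau> = meeting_time R in
      card {k\<in>boundary_sources S N. (\<tau> i < \<tau> k \<and> \<tau> k < \<tau> j) \<or> (\<tau> j < \<tau> k \<and> \<tau> k < \<tau> i)})"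

definition boundary_arc :: "('p, 'q) presentation \<Rightarrow> 'p \<Rightarrow> 'p \<Rightarrow> real \<Rightarrow> 'p" where
  "boundary_arc R j i s =
     (let a = meeting_time R j; b = meeting_time R i; l = (if a < b then b - a else b - a + 1)
      in reglue R (traverse R (frac (a + s * l))))"

section \<open>Closed planar curves of paths and their rotation numbers\<close>

definition drawn_piece ::
    "('p, 'q) presentation \<Rightarrow> (real \<Rightarrow> 'p) \<Rightarrow> real \<Rightarrow> real \<Rightarrow> (real \<Rightarrow> complex) \<Rightarrow> bool" where
  "drawn_piece R c u v w \<longleftrightarrow> path w \<and> path_image w \<subseteq> domain R \<and>
     (\<forall>s\<in>{0..1}. proj R (w s) = c (u + s * (v - u))) \<and>
     (\<forall>s\<in>{0<..<1}. w s \<notin> polygon_sides (genus R))"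

definition clockwise_side_arc :: "nat \<Rightarrow> complex \<Rightarrow> complex \<Rightarrow> (real \<Rightarrow> complex) \<Rightarrow> bool" where
  "clockwise_side_arc g z w q \<longleftrightarrow>
     (\<exists>a b. b < a \<and> a - b < 4 * real g \<and> polygon_point g a = z \<and> polygon_point g b = w \<and>
        q = (\<lambda>s. polygon_point g (a - s * (a - b))))"

text \<open>\<open>drawn R c u w\<close>: the planar path \<open>w\<close> is the drawing of \<open>c\<close> from time \<open>u\<close> to time 1.\<close>

inductive drawn ::
    "('p, 'q) presentation \<Rightarrow> (real \<Rightarrow> 'p) \<Rightarrow> real \<Rightarrow> (real \<Rightarrow> complex) \<Rightarrow> bool"
  for R :: "('p, 'q) presentation" and c :: "real \<Rightarrow> 'p" where
  inside: "u < 1 \<Longrightarrow> drawn_piece R c u 1 w \<Longrightarrow> drawn R c u w"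
| leaving: "u < v \<Longrightarrow> v < 1 \<Longrightarrow> drawn_piece R c u v w \<Longrightarrow> drawn R c v w' \<Longrightarrow>
    clockwise_side_arc (genus R) (pathfinish w) (pathstart w') q \<Longrightarrow>
    drawn R c u (w +++ (q +++ w'))"

fun join_all :: "(real \<Rightarrow> complex) list \<Rightarrow> real \<Rightarrow> complex" where
  "join_all [] = (\<lambda>_. 0)"
| "join_all [w] = w"
| "join_all (w # w' # ws) = w +++ join_all (w' # ws)"

definition path_curve ::
    "('p, 'e) network \<Rightarrow> ('p, 'q) presentation \<Rightarrow> 'p \<Rightarrow> 'p \<Rightarrow> 'e list \<Rightarrow> (real \<Rightarrow> complex) \<Rightarrow> bool" where
  "path_curve N R i j P C \<longleftrightarrow>
     (\<exists>ws. list_all2 (\<lambda>c w. drawn R c 0 w) (map (curve N) P @ [boundary_arc R j i]) ws \<and>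
        C = join_all ws)"

text \<open>
  Closed planar curves are represented by maps of period 1. A smoothing of \<open>C\<close> replaces
  finitely many embedded arcs of \<open>C\<close>, each crossing a small disk, by embedded arcs crossing the same
  disk, so that the result is smooth and regular. For an embedded arc crossing a disk the
  total turning is determined by the behaviour at its ends; hence all smoothings of \<open>C\<close>
  have the same rotation number, also when some corner is a cusp.
\<close>

definition crosses_disk :: "(real \<Rightarrow> complex) \<Rightarrow> real \<Rightarrow> real \<Rightarrow> complex \<Rightarrow> real \<Rightarrow> bool" where
  "crosses_disk C a b z r \<longleftrightarrow> inj_on C {a..b} \<and> C a \<in> sphere z r \<and> C b \<in> sphere z r \<and>
     C ` {a<..<b} \<subseteq> ball z r"

definition smoothing :: "(real \<Rightarrow> complex) \<Rightarrow> (real \<Rightarrow> complex) \<Rightarrow> bool" where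
  "smoothing C C' \<longleftrightarrow>
     smooth_immersion_on UNIV C' \<and> (\<forall>t. C' (t + 1) = C' t) \<and>
     (\<exists>M. finite M \<and>
        (\<forall>(a, b)\<in>M. a < b \<and> b < a + 1 \<and>
           (\<exists>z r. crosses_disk C a b z r \<and> crosses_disk C' a b z r)) \<and>
        (\<forall>(a, b)\<in>M. \<forall>(a', b')\<in>M. \<forall>n::int. (a, b) \<noteq> (a', b') \<or> n \<noteq> 0 \<longrightarrow>
           {a..b} \<inter> {a' + of_int n..b' + of_int n} = {}) \<and>
        (\<forall>t. (\<forall>(a, b)\<in>M. \<forall>n::int. t \<notin> {a + of_int n..b + of_int n}) \<longrightarrow> C' t = C t))"

text \<open>The degree of a loop in the unit circle is its winding number about 0.\<close>

definition rotation_number :: "(real \<Rightarrow> complex) \<Rightarrow> int" where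
  "rotation_number C =
     (THE n. winding_number (\<lambda>t. sgn (vector_derivative C (at t))) 0 = of_int n)"

definition path_rotation ::
    "('p, 'e) network \<Rightarrow> ('p, 'q) presentation \<Rightarrow> 'p \<Rightarrow> 'p \<Rightarrow> 'e list \<Rightarrow> int" where
  "path_rotation N R i j P =
     (THE r. \<exists>C C'. path_curve N R i j P C \<and> smoothing (\<lambda>t. C (frac t)) C' \<and>
        r = rotation_number C')"

text \<open>
  Since \<open>i\<close> is a source, the only path from \<open>i\<close> to \<open>i\<close> is empty; it has no curve and counts with
  sign \<open>+1\<close>.
\<close>

definition path_sign ::
    "'p surface \<Rightarrow> ('p, 'e) network \<Rightarrow> ('p, 'q) presentation \<Rightarrow> 'p \<Rightarrow> 'p \<Rightarrow> 'e list \<Rightarrow> real" where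
  "path_sign S N R i j P =
     (if i = j then 1
      else (-1) powi (int (sources_between S N R i j) + path_rotation N R i j P + 1))"

definition B_entry ::
    "'p surface \<Rightarrow> ('p, 'e) network \<Rightarrow> ('p, 'q) presentation \<Rightarrow> 'p \<Rightarrow> 'p \<Rightarrow> 'e power_series" where
  "B_entry S N R i j =
     formal_sum (paths N i j) (\<lambda>P. monomial (path_sign S N R i j P) (mset P))"

end

theory Submission
  imports Defs
begin

text \<open>
  The weights of all paths with the same edge multiset agree, so equality of the matrices
  \<open>A(N, \<epsilon>)\<close> and \<open>A(N, \<epsilon>')\<close> says that \<open>\<epsilon>\<close> and \<open>\<epsilon>'\<close> have equal products along every path from a
  boundary source to a boundary vertex. Hence the quotient of the two products along a path from
  a boundary source to \<open>v\<close> does not depend on the path: continue to the boundary and compare.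
  This quotient, as a function of \<open>v\<close>, is the gauge transformation.
\<close>

lemma A_entry_mset:
  "A_entry N a i j (mset P) = real (card {Q \<in> paths N i j. mset Q = mset P}) * (\<Prod>e\<leftarrow>P. a e)"
proof -
  let ?X = "{Q \<in> paths N i j. mset Q = mset P}"
  have wt: "wt a Q (mset P) = (if mset Q = mset P then \<Prod>e\<leftarrow>P. a e else 0)" for Q
  proof -
    have "(\<Prod>e\<leftarrow>Q. a e) = (\<Prod>e\<leftarrow>P. a e)" if "mset Q = mset P"
      using that by (metis mset_map prod_mset_prod_list)
    then show ?thesis by (auto simp: wt_def monomial_def)
  qed
  have "finite ?X"
    by (rule finite_subset[OF _ mset_eq_finite[of P]]) auto
  then have "A_entry N a i j (mset P) = (\<Sum>Q\<in>?X. wt a Q (mset P))"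
    \<comment> \<open>\<open>formal_sum\<close> adds only the nonzero terms. They all lie in the
      finite set \<open>?X\<close>, and any further terms of \<open>?X\<close> vanish.\<close>
    unfolding A_entry_def formal_sum_def
    by (intro sum.mono_neutral_left) (auto simp: wt split: if_splits)
  also have "\<dots> = real (card ?X) * (\<Prod>e\<leftarrow>P. a e)"
    by (simp add: wt)
  finally show ?thesis .
qed

text \<open>No cancellation can occur in the coefficient at \<open>mset P\<close>: it is the common
  product times the number of paths with that multiset. This number does not depend on the weights
  and is positive because \<open>P\<close> is counted, so it can be divided out.\<close>

lemma prod_eq_if_A_entry_eq:
  assumes eq: "A_entry N a i j = A_entry N b i j" and P: "P \<in> paths N i j"
  shows "(\<Prod>e\<leftarrow>P. a e) = (\<Prod>e\<leftarrow>P. b e)"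
proof -
  let ?X = "{Q \<in> paths N i j. mset Q = mset P}"
  have "finite ?X"
    by (rule finite_subset[OF _ mset_eq_finite[of P]]) auto
  moreover have "P \<in> ?X" using P by simp
  ultimately have "card ?X \<noteq> 0" by auto
  moreover have "real (card ?X) * (\<Prod>e\<leftarrow>P. a e) = real (card ?X) * (\<Prod>e\<leftarrow>P. b e)"
    using arg_cong[OF eq, of "\<lambda>f. f (mset P)"] by (simp add: A_entry_mset)
  ultimately show ?thesis by simp
qed

lemma (in wf_digraph) gauge_from_awalk_products:
  fixes a b :: "'b \<Rightarrow> 'c::field"
  assumes a: "\<And>e. e \<in> arcs G \<Longrightarrow> a e \<noteq> 0" and b: "\<And>e. e \<in> arcs G \<Longrightarrow> b e \<noteq> 0"
    and eq: "\<And>i j P. i \<in> I \<Longrightarrow> j \<in> K \<Longrightarrow> awalk i P j \<Longrightarrow> (\<Prod>e\<leftarrow>P. a e) = (\<Prod>e\<leftarrow>P. b e)"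
    and from_I: "\<And>e. e \<in> arcs G \<Longrightarrow> \<exists>i\<in>I. \<exists>P. awalk i P (tail G e)"
    and to_K: "\<And>e. e \<in> arcs G \<Longrightarrow> \<exists>j\<in>K. \<exists>P. awalk (head G e) P j"
  obtains g where "\<And>v. g v \<noteq> 0" and "\<And>v. v \<in> K \<Longrightarrow> g v = 1"
    and "\<And>e. e \<in> arcs G \<Longrightarrow> b e = inverse (g (head G e)) * a e * g (tail G e)"
proof
  define q where "q P = (\<Prod>e\<leftarrow>P. a e) / (\<Prod>e\<leftarrow>P. b e)" for P
  define reach where "reach v P \<longleftrightarrow> (\<exists>i\<in>I. awalk i P v)" for v P
  \<comment> \<open>The value 1 at vertices not reached from \<open>I\<close> keeps \<open>g\<close>
    nonzero everywhere.\<close>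
  define g where "g v = (if \<exists>P. reach v P then q (SOME P. reach v P) else 1)" for v
  have nz: "(\<Prod>e\<leftarrow>P. a e) \<noteq> 0 \<and> (\<Prod>e\<leftarrow>P. b e) \<noteq> 0" if "awalk i P v" for i P v
    using that a b by (auto simp: awalk_def prod_list_zero_iff)
  have q_append: "q (P @ P') = q P * q P'" for P P'
    by (simp add: q_def)
  have q_1: "q P = 1" if P: "reach j P" and j: "j \<in> K" for j P
  proof -
    obtain i where "i \<in> I" "awalk i P j" using P by (auto simp: reach_def)
    then show ?thesis using eq[of i j P] nz[of i P j] j by (simp add: q_def)
  qed
  have q_nz: "q P \<noteq> 0" if "reach v P" for v P
    using that nz by (auto simp: q_def reach_def)
  have reach_some: "reach v (SOME P. reach v P)" if "reach v P" for v P
    using that by (rule someI)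
  show "g v \<noteq> 0" for v
    using q_nz[OF reach_some[of v]] by (auto simp: g_def)
  show "g v = 1" if "v \<in> K" for v
    using q_1[OF reach_some that] by (auto simp: g_def)
  \<comment> \<open>Independence of the walk: \<open>P\<close> and the chosen walk, both continued
    by the same \<open>Q\<close>, end in \<open>K\<close>, so each has quotient
    \<open>1 / q Q\<close>.\<close>
  have g_eq: "g v = q P" if "reach v P" "awalk v Q j" "j \<in> K" for v P Q j
  proof -
    have "q P' * q Q = 1" if "reach v P'" for P'
    proof -
      have "reach j (P' @ Q)"
        using \<open>reach v P'\<close> \<open>awalk v Q j\<close> unfolding reach_def by (blast intro: awalk_appendI)
      then show ?thesis using q_1[OF _ \<open>j \<in> K\<close>] q_append by metis
    qed
    from this[OF that(1)] this[OF reach_some[OF that(1)]]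
    have "q (SOME P. reach v P) = q P" by (metis mult_cancel_right mult_zero_right zero_neq_one)
    then show ?thesis using that(1) by (auto simp: g_def)
  qed
  show "b e = inverse (g (head G e)) * a e * g (tail G e)" if e: "e \<in> arcs G" for e
  proof -
    obtain P where P: "reach (tail G e) P" using from_I[OF e] by (auto simp: reach_def)
    obtain Q j where Q: "awalk (head G e) Q j" "j \<in> K" using to_K[OF e] by blast
    have arc: "awalk (tail G e) [e] (head G e)" using e by (simp add: arc_implies_awalk)
    \<comment> \<open>The tail reaches \<open>K\<close> through \<open>e\<close> followed by
      \<open>Q\<close>. The walks \<open>P\<close> and \<open>P @ [e]\<close> then compute
      \<open>g\<close> at the two ends of \<open>e\<close>, and their quotients differ by the factor
      \<open>a e / b e\<close>.\<close>
    have "g (tail G e) = q P" using g_eq[OF P awalk_appendI[OF arc Q(1)] Q(2)] .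
    moreover have "reach (head G e) (P @ [e])"
      using P arc unfolding reach_def by (blast intro: awalk_appendI)
    then have "g (head G e) = q (P @ [e])" using g_eq Q by blast
    then have "g (head G e) = q P * (a e / b e)" by (simp add: q_append) (simp add: q_def)
    moreover have "q P \<noteq> 0" using P by (rule q_nz)
    ultimately show ?thesis using a[OF e] b[OF e] by (simp add: nonzero_inverse_mult_distrib)
  qed
qed

theorem corollary11:
  fixes S :: "'p surface" and N :: "('p, 'e) network" and R :: "('p, 'q) presentation"
    and \<epsilon> \<epsilon>' :: "'e \<Rightarrow> real"
  assumes "closed_orientable_surface_with_boundary S"
    and "embedded_network S N"
    and "valid_presentation S N R"
    and "\<forall>v\<in>verts (graph N). \<exists>i\<in>boundary_vertices S N. \<exists>j\<in>boundary_vertices S N.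
           \<exists>P\<in>paths N i j. v \<in> set (pre_digraph.awalk_verts (graph N) i P)"
    and "\<forall>e\<in>arcs (graph N). \<epsilon> e \<in> {1, -1}"
    and "\<forall>e\<in>arcs (graph N). \<epsilon>' e \<in> {1, -1}"
    and "\<forall>i\<in>boundary_sources S N. \<forall>j\<in>boundary_vertices S N.
           B_entry S N R i j = A_entry N \<epsilon> i j"
    and "\<forall>i\<in>boundary_sources S N. \<forall>j\<in>boundary_vertices S N.
           B_entry S N R i j = A_entry N \<epsilon>' i j"
  shows "gauge_equivalent S N \<epsilon> \<epsilon>'"
proof -
  let ?G = "graph N" and ?K = "boundary_vertices S N" and ?I = "boundary_sources S N"
  interpret fin_digraph ?G using assms(2) by (simp add: embedded_network_def)
  have source: "i \<in> ?I" if "i \<in> ?K" "e \<in> arcs ?G" "tail ?G e = i" for i e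
  proof -
    have "e \<in> out_arcs ?G i" using that by simp
    moreover have "in_arcs ?G i = {} \<or> out_arcs ?G i = {}"
      using assms(2) that(1) by (simp add: embedded_network_def)
    ultimately show ?thesis using that(1) by (auto simp: boundary_sources_def)
  qed
  have through: "\<exists>i\<in>?K. \<exists>j\<in>?K. \<exists>P Q. awalk i P v \<and> awalk v Q j" if v: "v \<in> verts ?G" for v
  proof -
    obtain i j P where "i \<in> ?K" "j \<in> ?K" "awalk i P j" "v \<in> set (awalk_verts i P)"
      using assms(4) v unfolding paths_def by blast
    then show ?thesis using awalk_decomp by meson
  qed
  have nz: "\<epsilon> e \<noteq> 0" "\<epsilon>' e \<noteq> 0" if "e \<in> arcs ?G" for e
    using assms(5,6) that by force+
  \<comment> \<open>The matrix \<open>B\<close> links the two: both \<open>A\<close> matrices equal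
    it, hence each other.\<close>
  have prod_eq: "(\<Prod>e\<leftarrow>P. \<epsilon> e) = (\<Prod>e\<leftarrow>P. \<epsilon>' e)" if "i \<in> ?I" "j \<in> ?K" "awalk i P j" for i j P
    using assms(7,8) that by (intro prod_eq_if_A_entry_eq[of N _ i j]) (auto simp: paths_def)
  have from_I: "\<exists>i\<in>?I. \<exists>P. awalk i P (tail ?G e)" if e: "e \<in> arcs ?G" for e
  proof -
    obtain i P where iP: "i \<in> ?K" "awalk i P (tail ?G e)"
      using through[of "tail ?G e"] e by auto
    \<comment> \<open>\<open>P\<close> may be empty; appending \<open>e\<close> guarantees a first
      arc leaving \<open>i\<close>, which makes the boundary vertex \<open>i\<close> a
      source.\<close>
    have "awalk i (P @ [e]) (head ?G e)"
      using iP(2) e by (auto intro: awalk_appendI simp: arc_implies_awalk)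
    then have "\<exists>e'\<in>arcs ?G. tail ?G e' = i"
      by (cases P) (auto simp: awalk_Cons_iff)
    then show ?thesis using source iP by blast
  qed
  have to_K: "\<exists>j\<in>?K. \<exists>P. awalk (head ?G e) P j" if "e \<in> arcs ?G" for e
    using through[of "head ?G e"] that by auto
  show ?thesis
  proof (rule gauge_from_awalk_products[of \<epsilon> \<epsilon>' ?I ?K])
    fix g
    assume g: "\<And>v. g v \<noteq> 0" "\<And>v. v \<in> ?K \<Longrightarrow> g v = 1"
      "\<And>e. e \<in> arcs ?G \<Longrightarrow> \<epsilon>' e = inverse (g (head ?G e)) * \<epsilon> e * g (tail ?G e)"
    \<comment> \<open>The normalization on \<open>?K\<close> inside \<open>gauge_act\<close> leaves
      \<open>g\<close> unchanged.\<close>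
    have "(\<lambda>v. if v \<in> ?K then 1 else g v) = g" using g(2) by auto
    then have "\<forall>e\<in>arcs ?G. \<epsilon>' e = gauge_act S N g \<epsilon> e" using g(3) by (simp add: gauge_act_def)
    moreover have "g \<in> gauge_group S N" using g(1) by (simp add: gauge_group_def)
    ultimately show ?thesis using nz by (auto simp: gauge_equivalent_def weight_space_def)
  qed (erule nz prod_eq from_I to_K | assumption)+
qed

end
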